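(* The non-zero Askey-Wilson moments for $b=-a$ and $d=-c$ are, for every integer $n\ge0$, $$4^n \mu_{2n}(a,-a,c,-c;q) = \sum_{m=0}^n \frac{(-a^2;q)_{2m}(a^2c^2;q^2)_m} {(qa^2c^2;q^2)_m} (-q^2)^{m} \sum_{s=0}^{2n+2} \left(\binom{2n+1}{s} - \binom{2n+1}{s-1} \right) \sum_{p=0}^{n-m-s} a^{-2n+4p+2s} \begin{bmatrix} m+p\\ m\end{bmatrix}_{q^2} \begin{bmatrix} n-p-s\\ m\end{bmatrix}_{q^2} q^{-2m(n-p-s)+m(m-1)}.$$
   Context: Let $a,b,c,d,q$ be indeterminates (generic parameters). The monic Askey-Wilson polynomials $P_n(x)=P_n(x;a,b,c,d;q)$ are defined by $P_{-1}=0$, $P_0=1$, $P_{n+1}=(x-b_n)P_n-\lambda_nP_{n-1}$, with $b_n=\frac12(a+a^{-1}-(A_n+C_n))$, $\lambda_n=\frac14A_{n-1}C_n$, where $$A_n=\frac{(1-abq^n)(1-acq^n)(1-adq^n)(1-abcdq^{n-1})}{a(1-abcdq^{2n-1})(1-abcdq^{2n})},\quad C_n=\frac{a(1-q^n)(1-bcq^{n-1})(1-bdq^{n-1})(1-cdq^{n-1})}{(1-abcdq^{2n-2})(1-abcdq^{2n-1})}$$ (for $n=0$ the common factor $1-abcdq^{-1}$ in $A_0$ is cancelled, and $C_0=0$). The moment $\mu_n(a,b,c,d;q)=L(x^n)$, where $L$ is the unique linear functional on polynomials in $x$ with $L(1)=1$ and $L(P_n)=0$ for all $n\ge1$ (so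 that $L(P_mP_n)=0$ for $m\neq n$). It is a rational function of $a,b,c,d,q$, symmetric in $a,b,c,d$. For $b=-a$, $d=-c$ one has $b_n=0$ for all $n$, so the odd moments vanish. Notation: $(x;p)_m=\prod_{i=0}^{m-1}(1-xp^i)$; $\begin{bmatrix} n\\k\end{bmatrix}_{p}=\frac{(p;p)_n}{(p;p)_k(p;p)_{n-k}}$ for $0\le k\le n$. Binomial coefficients $\binom nk$ with $k<0$ or $k>n$ are $0$. A sum whose upper limit is smaller than its lower limit is empty. *)

theory Defs
  imports "HOL-Computational_Algebra.Polynomial"
begin

definition qpoch :: "'a::field \<Rightarrow> 'a \<Rightarrow> nat \<Rightarrow> 'a" where
  "qpoch x p m = (\<Prod>i<m. 1 - x * p ^ i)"

definition qbinom :: "'a::field \<Rightarrow> nat \<Rightarrow> nat \<Rightarrow> 'a" where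
  "qbinom p n k = (if k \<le> n then qpoch p p n / (qpoch p p k * qpoch p p (n - k)) else 0)"

(* In the case n = 0 the common factor 1 - a b c d / q of numerator and denominator is cancelled. *)
definition aw_A :: "'a::field \<Rightarrow> 'a \<Rightarrow> 'a \<Rightarrow> 'a \<Rightarrow> 'a \<Rightarrow> nat \<Rightarrow> 'a" where
  "aw_A a b c d q n =
    (if n = 0 then (1 - a*b) * (1 - a*c) * (1 - a*d) / (a * (1 - a*b*c*d))
     else (1 - a*b*q^n) * (1 - a*c*q^n) * (1 - a*d*q^n) * (1 - a*b*c*d*q^(n-1)) /
          (a * (1 - a*b*c*d*q^(2*n-1)) * (1 - a*b*c*d*q^(2*n))))"

definition aw_C :: "'a::field \<Rightarrow> 'a \<Rightarrow> 'a \<Rightarrow> 'a \<Rightarrow> 'a \<Rightarrow> nat \<Rightarrow> 'a" where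
  "aw_C a b c d q n =
    (if n = 0 then 0
     else a * (1 - q^n) * (1 - b*c*q^(n-1)) * (1 - b*d*q^(n-1)) * (1 - c*d*q^(n-1)) /
          ((1 - a*b*c*d*q^(2*n-2)) * (1 - a*b*c*d*q^(2*n-1))))"

definition aw_b :: "'a::field \<Rightarrow> 'a \<Rightarrow> 'a \<Rightarrow> 'a \<Rightarrow> 'a \<Rightarrow> nat \<Rightarrow> 'a" where
  "aw_b a b c d q n = (a + inverse a - (aw_A a b c d q n + aw_C a b c d q n)) / 2"

(* Only used for n > 0: the value at n = 0 would be multiplied by the zero polynomial of index -1. *)
definition aw_lambda :: "'a::field \<Rightarrow> 'a \<Rightarrow> 'a \<Rightarrow> 'a \<Rightarrow> 'a \<Rightarrow> nat \<Rightarrow> 'a" where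
  "aw_lambda a b c d q n = aw_A a b c d q (n - 1) * aw_C a b c d q n / 4"

fun aw_poly :: "'a::field \<Rightarrow> 'a \<Rightarrow> 'a \<Rightarrow> 'a \<Rightarrow> 'a \<Rightarrow> nat \<Rightarrow> 'a poly" where
  "aw_poly a b c d q 0 = 1"
| "aw_poly a b c d q (Suc 0) = [:- aw_b a b c d q 0, 1:]"
| "aw_poly a b c d q (Suc (Suc n)) =
     [:- aw_b a b c d q (Suc n), 1:] * aw_poly a b c d q (Suc n)
     - smult (aw_lambda a b c d q (Suc n)) (aw_poly a b c d q n)"

definition is_aw_functional ::
    "'a::field \<Rightarrow> 'a \<Rightarrow> 'a \<Rightarrow> 'a \<Rightarrow> 'a \<Rightarrow> ('a poly \<Rightarrow> 'a) \<Rightarrow> bool" where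
  "is_aw_functional a b c d q L \<longleftrightarrow>
     Vector_Spaces.linear smult (*) L \<and> L 1 = 1 \<and> (\<forall>n\<ge>1. L (aw_poly a b c d q n) = 0)"

(* Existence and uniqueness are shown in ex1_aw_functional below. *)
definition aw_functional :: "'a::field \<Rightarrow> 'a \<Rightarrow> 'a \<Rightarrow> 'a \<Rightarrow> 'a \<Rightarrow> 'a poly \<Rightarrow> 'a" where
  "aw_functional a b c d q = (THE L. is_aw_functional a b c d q L)"

definition aw_moment :: "'a::field \<Rightarrow> 'a \<Rightarrow> 'a \<Rightarrow> 'a \<Rightarrow> 'a \<Rightarrow> nat \<Rightarrow> 'a" where
  "aw_moment a b c d q n = aw_functional a b c d q (monom 1 n)"

lemma linear_smult_times_iff:
  fixes L :: "'a::field poly \<Rightarrow> 'a"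
  shows "Vector_Spaces.linear smult (*) L \<longleftrightarrow>
    (\<forall>p r. L (p + r) = L p + L r) \<and> (\<forall>t p. L (smult t p) = t * L p)"
proof -
  have "vector_space (smult :: 'a \<Rightarrow> 'a poly \<Rightarrow> 'a poly)"
    by unfold_locales (simp_all add: smult_add_right smult_add_left)
  moreover have "vector_space ((*) :: 'a \<Rightarrow> 'a \<Rightarrow> 'a)"
    by unfold_locales (simp_all add: algebra_simps)
  ultimately show ?thesis
    by (simp add: Vector_Spaces.linear_def module_hom_def module_hom_axioms_def
        vector_space_def module_def)
qed

lemma aw_poly_monic: "degree (aw_poly a b c d q n) = n \<and> lead_coeff (aw_poly a b c d q n) = 1"
proof (induction n rule: less_induct)
  case (less n)
  consider "n = 0" | "n = 1" | k where "n = Suc (Suc k)"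
    by (metis One_nat_def not0_implies_Suc)
  then show ?case
  proof cases
    case 3
    let ?P = "aw_poly a b c d q"
    have 1: "degree (?P (Suc k)) = Suc k" "lead_coeff (?P (Suc k)) = 1" "degree (?P k) = k"
      using less[of "Suc k"] less[of k] 3 by auto
    then have "?P (Suc k) \<noteq> 0" by force
    let ?u = "[:- aw_b a b c d q (Suc k), 1:]"
    have 2: "degree (?u * ?P (Suc k)) = n" "lead_coeff (?u * ?P (Suc k)) = 1"
      using 1 3 \<open>?P (Suc k) \<noteq> 0\<close>
       apply (subst degree_mult_eq; simp)
      using 1 by (simp only: lead_coeff_mult) simp
    have d: "degree (- smult (aw_lambda a b c d q (Suc k)) (?P k)) < n"
      using 1 3 degree_smult_le[of "aw_lambda a b c d q (Suc k)" "?P k"] by simp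
    have e: "?P n = ?u * ?P (Suc k) + - smult (aw_lambda a b c d q (Suc k)) (?P k)"
      using 3 by simp
    have "degree (?P n) = n"
      unfolding e using d 2 by (subst degree_add_eq_left) auto
    moreover have "lead_coeff (?P n) = 1"
      using lead_coeff_add_le[of "- smult (aw_lambda a b c d q (Suc k)) (?P k)" "?u * ?P (Suc k)"] d 2
      unfolding e by (simp only: add.commute)
    ultimately show ?thesis by simp
  qed auto
qed

function aw_mom_aux :: "'a::field \<Rightarrow> 'a \<Rightarrow> 'a \<Rightarrow> 'a \<Rightarrow> 'a \<Rightarrow> nat \<Rightarrow> 'a" where
  "aw_mom_aux a b c d q n =
    (if n = 0 then 1 else - (\<Sum>k<n. coeff (aw_poly a b c d q n) k * aw_mom_aux a b c d q k))"
  by pat_completeness auto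
termination by (relation "measure (\<lambda>(a, b, c, d, q, n). n)") auto

declare aw_mom_aux.simps [simp del]

theorem ex1_aw_functional: "\<exists>!L. is_aw_functional a b c d q L"
proof (rule ex_ex1I)
  let ?P = "aw_poly a b c d q" and ?m = "aw_mom_aux a b c d q"
  define L where "L p = (\<Sum>k\<le>degree p. coeff p k * ?m k)" for p
  have L_le: "L p = (\<Sum>k\<le>N. coeff p k * ?m k)" if "degree p \<le> N" for p N
    unfolding L_def using that
    by (intro sum.mono_neutral_left) (auto simp: coeff_eq_0)
  have "L (p + r) = L p + L r" for p r
  proof -
    let ?N = "max (degree p) (degree r)"
    show ?thesis
      using L_le[of p ?N] L_le[of r ?N] L_le[of "p + r" ?N]
      by (simp add: degree_add_le sum.distrib algebra_simps)
  qed
  moreover have "L (smult t p) = t * L p" for t p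
    using L_le[OF degree_smult_le[of t p]] L_le[of p "degree p"]
    by (simp add: sum_distrib_left mult.assoc)
  moreover have "L 1 = 1" by (simp add: L_def aw_mom_aux.simps)
  moreover have "L (?P n) = 0" if "n \<ge> 1" for n
  proof -
    have "L (?P n) = (\<Sum>k<n. coeff (?P n) k * ?m k) + ?m n"
      using aw_poly_monic[of a b c d q n, THEN conjunct1] aw_poly_monic[of a b c d q n, THEN conjunct2]
      by (simp only: L_def lessThan_Suc_atMost[symmetric] sum.lessThan_Suc mult_1)
    then show ?thesis using that by (subst (asm) (2) aw_mom_aux.simps) simp
  qed
  ultimately show "\<exists>L. is_aw_functional a b c d q L"
    unfolding is_aw_functional_def linear_smult_times_iff by blast
next
  let ?P = "aw_poly a b c d q"
  fix L M assume "is_aw_functional a b c d q L" "is_aw_functional a b c d q M"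
  then have add: "L (p + r) = L p + L r" "M (p + r) = M p + M r"
    and sm: "L (smult t p) = t * L p" "M (smult t p) = t * M p"
    and one: "L 1 = M 1" and P: "n \<ge> 1 \<Longrightarrow> L (?P n) = M (?P n)" for p r t n
    unfolding is_aw_functional_def linear_smult_times_iff by auto
  have "L p = M p" if "degree p \<le> n" for p n
    using that
  proof (induction n arbitrary: p rule: less_induct)
    case (less n)
    show ?case
    proof (cases "n = 0")
      case True
      with less.prems obtain t where "p = smult t 1" by (metis degree_eq_zeroE le_zero_eq smult_one)
      then show ?thesis by (simp only: sm one)
    next
      case False
      let ?r = "p + smult (- coeff p n) (?P n)"
      have "degree ?r \<le> n - 1"
      proof (rule degree_le, intro allI impI)
        fix i assume "n - 1 < i"
        then consider "i = n" | "i > n" by linarith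
        then show "coeff ?r i = 0"
          using aw_poly_monic[of a b c d q n] less.prems by cases (auto simp: coeff_eq_0)
      qed
      then have r: "L ?r = M ?r" using less.IH[of "n - 1" ?r] False by simp
      have "p = ?r + smult (coeff p n) (?P n)" by simp
      then show ?thesis using add sm r P[of n] False by (metis One_nat_def Suc_leI neq0_conv)
    qed
  qed
  then show "L = M" by blast
qed

end

(* Write A = a^2, Q = q^2, y = 4 x^2 and Phi_m = (1 - 2 A Q^i cos 2t + A^2 Q^(2i)) multiplied over i < m,
   where x = cos t.  The odd moments vanish by parity.  For the even ones, L (Phi_m P_k) has a product
   form for k even, and so has L (x Phi_m P_k) for k odd; multiplying by x passes from one family to
   the other, so both follow from the three-term recurrence by induction on m, and k = 0 gives
   L Phi_m.  It remains to expand y^n in the Phi_m.  With the Chebyshev polynomials U_N of the second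
   kind, y^n is the ballot-number combination of the U_(n-s) (cos 2t), and since multiplication by
   2 cos 2t sends Phi_m to a combination of Phi_m and Phi_(m+1), the generating function of the
   coefficient of Phi_m in U_N is a product of geometric series, whose coefficients are the
   convolutions of q-binomials in the formula. *)
theory Submission
  imports Defs "HOL-Computational_Algebra.Formal_Power_Series"
begin

subsection \<open>Mixed moments in closed form\<close>

lemma qpoch_0 [simp]: "qpoch x p 0 = 1"
  by (simp add: qpoch_def)

lemma qpoch_Suc: "qpoch x p (Suc n) = qpoch x p n * (1 - x * p ^ n)"
  by (simp add: qpoch_def)

lemma qpoch_2: "qpoch x p 2 = (1 - x) * (1 - x * p)"
  by (simp add: qpoch_def numeral_2_eq_2)

lemma qpoch_Suc_left: "qpoch x p (Suc n) = (1 - x) * qpoch (x * p) p n"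
  by (simp add: qpoch_def prod.lessThan_Suc_shift mult.assoc del: prod.lessThan_Suc)

lemma qpoch_nonzero: "(\<And>i. i < n \<Longrightarrow> x * p ^ i \<noteq> 1) \<Longrightarrow> qpoch x p n \<noteq> 0"
  by (auto simp: qpoch_def)

text \<open>For p nonzero this is p^(m k) (p^(-m); p)_k, cleared of negative powers. It vanishes for
  k > m, which encodes the orthogonality of P_(2k) to Phi_m.\<close>

definition qfall :: "'a::field \<Rightarrow> nat \<Rightarrow> nat \<Rightarrow> 'a" where
  "qfall p m k = (\<Prod>i<k. p ^ m - p ^ i)"

lemma qfall_0 [simp]: "qfall p m 0 = 1"
  by (simp add: qfall_def)

lemma qfall_Suc: "qfall p m (Suc k) = qfall p m k * (p ^ m - p ^ k)"
  by (simp add: qfall_def)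

text \<open>The factor i = 0 splits off, and each remaining p^(m+1) - p^(i+1) releases one p.
  Lowering m and k together is what \<open>even_mixed_Suc\<close> needs.\<close>

lemma qfall_Suc_Suc: "qfall p (Suc m) (Suc k) = (p ^ Suc m - 1) * p ^ k * qfall p m k"
proof -
  have "(\<Prod>i<k. p ^ Suc m - p ^ Suc i) = (\<Prod>i<k. p * (p ^ m - p ^ i))"
    by (intro prod.cong) (auto simp: algebra_simps)
  also have "\<dots> = p ^ k * qfall p m k"
    by (simp add: qfall_def prod.distrib)
  finally show ?thesis
    by (simp add: qfall_def prod.lessThan_Suc_shift del: prod.lessThan_Suc)
qed

lemma qfall_zero_left: "qfall p 0 (Suc k) = 0"
  by (simp add: qfall_def prod.lessThan_Suc_shift del: prod.lessThan_Suc)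

text \<open>With $A = a^2$, $B = c^2$ and $\Phi_m$ the polynomial \<open>aw_basis\<close> below, these are the
  values of $4^k L(\Phi_m P_{2k})$ and $4^{k+1} L(x \Phi_m P_{2k+1})$; the closed forms come from the
  $q$-analogue of the Pfaff-Saalschuetz sum.\<close>

definition even_mixed :: "'a::field \<Rightarrow> 'a \<Rightarrow> 'a \<Rightarrow> nat \<Rightarrow> nat \<Rightarrow> 'a" where
  "even_mixed A B q m k =
     A ^ k * qfall (q^2) m k * qpoch (A * B) (q^2) m * qpoch (- A) q (2 * m)
     * qpoch q (q^2) k * qpoch (- B) q (2 * k)
     / (qpoch (A * B * q ^ (2 * k - 1)) (q^2) k * qpoch (A * B * q) (q^2) (m + k))"

definition odd_mixed :: "'a::field \<Rightarrow> 'a \<Rightarrow> 'a \<Rightarrow> nat \<Rightarrow> nat \<Rightarrow> 'a" where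
  "odd_mixed A B q m k =
     A ^ k * qfall (q^2) m k * qpoch (A * B) (q^2) m * qpoch (- A) q (2 * m + 1)
     * qpoch q (q^2) (k + 1) * qpoch (- B) q (2 * k + 1)
     / (qpoch (A * B * q ^ (2 * k + 1)) (q^2) k * qpoch (A * B * q) (q^2) (m + k + 1))"

(* The case n = 1 is separate because the factor 1 - A B / q, which cancels there, may vanish. *)
definition even_lambda :: "'a::field \<Rightarrow> 'a \<Rightarrow> 'a \<Rightarrow> nat \<Rightarrow> 'a" where
  "even_lambda A B q n =
     (if n = 0 then 0
      else if n = 1 then (1 - q) * (1 + A) * (1 + B) / (1 - A * B * q)
      else (1 - q ^ n) * (1 + A * q ^ (n - 1)) * (1 + B * q ^ (n - 1)) * (1 - A * B * q ^ (n - 2))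
           / ((1 - A * B * q ^ (2 * n - 3)) * (1 - A * B * q ^ (2 * n - 1))))"

section \<open>Recurrences linking the even and odd mixed moments\<close>

context
  fixes A B q :: "'a::field"
  assumes nz: "\<And>k. A * B * q ^ k \<noteq> 1"
begin

lemma qpoch_ABq_nonzero: "qpoch (A * B * q ^ i) (q^2) k \<noteq> 0"
proof (rule qpoch_nonzero)
  fix j
  show "A * B * q ^ i * (q^2) ^ j \<noteq> 1"
    using nz[of "i + 2 * j"] by (simp add: power_add power_mult mult.assoc)
qed

text \<open>The index 2j + 3 stays clear of the special case n = 1 and of truncated subtraction.
  Powers of q become powers of (q^2)^j, the variable v of the rational identities below.\<close>

lemma even_lambda_odd:
  "even_lambda A B q (2 * j + 3) =
     (1 - q^3 * (q^2) ^ j) * (1 + A * q^2 * (q^2) ^ j) * (1 + B * q^2 * (q^2) ^ j) * (1 - A * B * q * (q^2) ^ j)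
     / ((1 - A * B * q^3 * ((q^2) ^ j)^2) * (1 - A * B * q^5 * ((q^2) ^ j)^2))"
proof -
  have "2 * (2 * j + 3) - 3 = 3 + 4 * j" "2 * (2 * j + 3) - 1 = 5 + 4 * j" by auto
  then show ?thesis
    by (simp add: even_lambda_def power_add mult_ac flip: power_mult)
       (simp add: numeral_eq_Suc mult_ac)
qed

lemma even_lambda_even:
  "even_lambda A B q (2 * j + 2) =
     (1 - q^2 * (q^2) ^ j) * (1 + A * q * (q^2) ^ j) * (1 + B * q * (q^2) ^ j) * (1 - A * B * (q^2) ^ j)
     / ((1 - A * B * q * ((q^2) ^ j)^2) * (1 - A * B * q^3 * ((q^2) ^ j)^2))"
proof -
  have "2 * (2 * j + 2) - 3 = 1 + 4 * j" "2 * (2 * j + 2) - 1 = 3 + 4 * j" by auto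
  then show ?thesis
    by (simp add: even_lambda_def power_add mult_ac flip: power_mult)
       (simp add: numeral_eq_Suc mult_ac)
qed

text \<open>This mirrors x P_(2k+1) = P_(2k+2) + lambda_(2k+1) P_(2k) tested against Phi_m, with
  \<open>even_lambda\<close> in the role of 4 lambda. Cancelling the common factor C leaves a
  rational identity.\<close>

lemma odd_mixed_eq:
  "odd_mixed A B q m k = even_mixed A B q m (Suc k) + even_lambda A B q (2 * k + 1) * even_mixed A B q m k"
\<comment> \<open>k = 0 meets the separate value of \<open>even_lambda\<close> at n = 1; otherwise k
  = j + 1.\<close>
proof (cases k)
  case 0
  define u where "u = (q^2) ^ m"
  have u: "q ^ (2 * m) = u" by (simp add: u_def power_mult)
  have d: "1 - A * B * q \<noteq> 0" "1 - A * B * q * u \<noteq> 0"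
    using nz[of 1] nz[of "Suc (2 * m)"] by (auto simp: u[symmetric] mult.assoc)
  define C where "C = qpoch (A * B) (q^2) m * qpoch (- A) q (2 * m) * (1 - q) * (1 + B) / qpoch (A * B * q) (q^2) m"
  have "odd_mixed A B q m 0 = C * ((1 + A * u) / (1 - A * B * q * u))"
    by (simp add: odd_mixed_def qpoch_Suc u C_def flip: u_def)
  moreover have "even_mixed A B q m 1 = C * (A * (u - 1) * (1 + B * q) / ((1 - A * B * q) * (1 - A * B * q * u)))"
    by (simp add: even_mixed_def qpoch_Suc u C_def qfall_Suc qpoch_2 flip: u_def) (simp add: mult_ac)
  moreover have "even_lambda A B q 1 * even_mixed A B q m 0 = C * ((1 + A) / (1 - A * B * q))"
    by (simp add: even_mixed_def even_lambda_def C_def mult_ac)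
  moreover have "(1 + A * u) / (1 - A * B * q * u) =
      A * (u - 1) * (1 + B * q) / ((1 - A * B * q) * (1 - A * B * q * u)) + (1 + A) / (1 - A * B * q)"
    using d by (simp add: divide_simps) algebra
  ultimately show ?thesis using 0 by (simp add: distrib_left)
next
  case (Suc j)
  define u where "u = (q^2) ^ m"
  define v where "v = (q^2) ^ j"
  have u: "q ^ (2 * m) = u" by (simp add: u_def power_mult)
  have v: "q ^ (2 * j) = v" by (simp add: v_def power_mult)
  have vv: "q ^ (j * 4) = v^2" by (simp add: v_def mult.commute flip: power_mult)
  \<comment> \<open>F is the stretch shared by the three k-dependent denominators; D1, D2 and D3
    supply the end factors in which they differ.\<close>
  define F where "F = qpoch (A * B * q ^ (2 * j + 3)) (q^2) j"
  have d: "1 - A * B * q * v \<noteq> 0" "1 - A * B * q^3 * v^2 \<noteq> 0" "1 - A * B * q^5 * v^2 \<noteq> 0"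
     "1 - A * B * q^3 * u * v \<noteq> 0"
    using nz[of "1 + 2 * j"] nz[of "3 + j * 4"] nz[of "5 + j * 4"] nz[of "3 + 2 * m + 2 * j"]
    by (auto simp: power_add u v vv mult.assoc)
  define C where "C = A ^ k * qfall (q^2) m k * qpoch (A * B) (q^2) m * qpoch (- A) q (2 * m)
     * qpoch q (q^2) k * qpoch (- B) q (2 * k) / (F * qpoch (A * B * q) (q^2) (m + k))"
  have D1: "qpoch (A * B * q ^ (2 * k - 1)) (q^2) k = (1 - A * B * q * v) * F"
    using Suc qpoch_Suc_left[of "A * B * q ^ (2 * j + 1)" "q^2" j]
    by (simp add: F_def v mult.assoc power2_eq_square power3_eq_cube mult.left_commute power_add)
  have D2: "qpoch (A * B * q ^ (2 * k + 1)) (q^2) k = F * (1 - A * B * q^3 * v^2)"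
  proof -
    have "A * B * q ^ (2 * j + 3) * (q^2) ^ j = A * B * q^3 * v^2"
      by (simp add: power_add v power2_eq_square[of v] flip: v_def)
    moreover have "2 * k + 1 = 2 * j + 3" using Suc by simp
    ultimately show ?thesis using Suc by (simp only: F_def qpoch_Suc)
  qed
  have D3: "qpoch (A * B * q ^ (2 * Suc k - 1)) (q^2) (Suc k) = F * (1 - A * B * q^3 * v^2) * (1 - A * B * q^5 * v^2)"
  proof -
    have "q ^ (2 * k + 1) = q^3 * v" "(q^2) ^ k = q^2 * v"
      using Suc by (simp_all add: v power3_eq_cube power2_eq_square[of q] v_def)
    then have "A * B * q ^ (2 * k + 1) * (q^2) ^ k = A * B * (q^3 * v) * (q^2 * v)"
      by (simp only:)
    also have "\<dots> = A * B * q^5 * v^2"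
      by (simp add: eval_nat_numeral)
    finally have "A * B * q ^ (2 * k + 1) * (q^2) ^ k = A * B * q^5 * v^2" .
    moreover have "2 * Suc k - 1 = 2 * k + 1" by simp
    ultimately show ?thesis using D2 by (simp only: qpoch_Suc)
  qed
  have 1: "odd_mixed A B q m k = C * ((1 + A * u) * (1 - q^3 * v) * (1 + B * q^2 * v)
      / ((1 - A * B * q^3 * v^2) * (1 - A * B * q^3 * u * v)))"
    unfolding odd_mixed_def D2 C_def
    using Suc by (simp add: qpoch_Suc u v power_add
        flip: u_def v_def; simp add: eval_nat_numeral mult_ac)
  have 2: "even_mixed A B q m (Suc k) = C * (A * (u - q^2 * v) * (1 - q^3 * v) * (1 + B * q^2 * v) * (1 + B * q^3 * v)
      / ((1 - A * B * q^3 * v^2) * (1 - A * B * q^5 * v^2) * (1 - A * B * q^3 * u * v)))"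
    unfolding even_mixed_def D3 C_def
    using Suc by (simp add: qpoch_Suc qfall_Suc u v power_add
        flip: u_def v_def; simp add: eval_nat_numeral mult_ac)
  have 3: "even_lambda A B q (2 * k + 1) * even_mixed A B q m k =
      C * ((1 - q^3 * v) * (1 + A * q^2 * v) * (1 + B * q^2 * v) / ((1 - A * B * q^3 * v^2) * (1 - A * B * q^5 * v^2)))"
    unfolding even_mixed_def D1 C_def
    using Suc even_lambda_odd[of j] d by (simp add: numeral_3_eq_3
        flip: u_def v_def; simp add: mult_ac)
  \<comment> \<open>With C cancelled this is all that remains, an identity in A, B, q, u and v
    alone.\<close>
  have 4: "(1 + A * u) * (1 - q^3 * v) * (1 + B * q^2 * v)
      / ((1 - A * B * q^3 * v^2) * (1 - A * B * q^3 * u * v)) =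
     A * (u - q^2 * v) * (1 - q^3 * v) * (1 + B * q^2 * v) * (1 + B * q^3 * v)
      / ((1 - A * B * q^3 * v^2) * (1 - A * B * q^5 * v^2) * (1 - A * B * q^3 * u * v)) +
     ((1 - q^3 * v) * (1 + A * q^2 * v) * (1 + B * q^2 * v) / ((1 - A * B * q^3 * v^2) * (1 - A * B * q^5 * v^2)))"
    using d by (simp add: divide_simps) algebra
  show ?thesis unfolding 1 2 3 4 by (simp add: distrib_left)
qed

text \<open>This mirrors Phi_(m+1) = (1 + A q^(2m))^2 Phi_m - 4 A q^(2m) x^2 Phi_m: one factor x
  stays with Phi_m, the other turns P_(2k) into P_(2k+1) + lambda_(2k) P_(2k-1), so two odd mixed
  moments appear.\<close>

lemma even_mixed_Suc:
  "even_mixed A B q (Suc m) k = (1 + A * (q^2) ^ m)^2 * even_mixed A B q m k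
    - A * (q^2) ^ m * (odd_mixed A B q m k
        + (if k = 0 then 0 else even_lambda A B q (2 * k) * odd_mixed A B q m (k - 1)))"
proof (cases k)
  case 0
  define u where "u = (q^2) ^ m"
  have u: "q ^ (2 * m) = u" by (simp add: u_def power_mult)
  have d: "1 - A * B * q * u \<noteq> 0"
    using nz[of "Suc (2 * m)"] by (auto simp: u[symmetric] mult.assoc)
  define C where "C = qpoch (A * B) (q^2) m * qpoch (- A) q (2 * m) / qpoch (A * B * q) (q^2) m"
  have 1: "even_mixed A B q (Suc m) 0 = C * ((1 - A * B * u) * (1 + A * u) * (1 + A * q * u) / (1 - A * B * q * u))"
    by (simp add: even_mixed_def qpoch_Suc u C_def flip: u_def)
  have 2: "odd_mixed A B q m 0 = C * ((1 - q) * (1 + B) * (1 + A * u) / (1 - A * B * q * u))"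
    by (simp add: odd_mixed_def qpoch_Suc u C_def flip: u_def)
  have 3: "even_mixed A B q m 0 = C"
    by (simp add: even_mixed_def C_def)
  have 4: "(1 - A * B * u) * (1 + A * u) * (1 + A * q * u) / (1 - A * B * q * u)
      = (1 + A * u)^2 - A * u * ((1 - q) * (1 + B) * (1 + A * u) / (1 - A * B * q * u))"
    using d by (simp add: divide_simps) algebra
  show ?thesis unfolding 0 u_def[symmetric] 1 2 3 4 by (simp add: right_diff_distrib mult_ac)
next
  case (Suc j)
  define u where "u = (q^2) ^ m"
  define v where "v = (q^2) ^ j"
  have u: "q ^ (2 * m) = u" by (simp add: u_def power_mult)
  have v: "q ^ (2 * j) = v" by (simp add: v_def power_mult)
  have vv: "q ^ (j * 4) = v^2" by (simp add: v_def mult.commute flip: power_mult)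
  define F where "F = qpoch (A * B * q ^ (2 * j + 3)) (q^2) j"
  define G where "G = qpoch (A * B * q ^ (2 * j + 1)) (q^2) j"
  define E where "E = qpoch (A * B * q) (q^2) (m + k)"
  have F: "F \<noteq> 0" unfolding F_def by (rule qpoch_ABq_nonzero)
  have G: "G \<noteq> 0" unfolding G_def by (rule qpoch_ABq_nonzero)
  have d: "1 - A * B * q * v \<noteq> 0" "1 - A * B * q^3 * v^2 \<noteq> 0" "1 - A * B * q * v^2 \<noteq> 0"
     "1 - A * B * q^3 * u * v \<noteq> 0"
    using nz[of "1 + 2 * j"] nz[of "3 + j * 4"] nz[of "1 + j * 4"] nz[of "3 + 2 * m + 2 * j"]
    by (auto simp: power_add u v vv mult.assoc)
  \<comment> \<open>The lower index j enters because \<open>qfall_Suc_Suc\<close> takes (m + 1, k)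
    to (m, j) and one term is \<open>odd_mixed\<close> at j. There the factor 1 + B q v comes from
    \<open>even_lambda\<close>.\<close>
  define C where "C = A ^ j * qfall (q^2) m j * qpoch (A * B) (q^2) m * qpoch (- A) q (2 * m)
     * qpoch q (q^2) k * qpoch (- B) q (2 * j) * (1 + B * v) * (1 + B * q * v) / (F * E)"
  have D1: "qpoch (A * B * q ^ (2 * k - 1)) (q^2) k = (1 - A * B * q * v) * F"
    using Suc qpoch_Suc_left[of "A * B * q ^ (2 * j + 1)" "q^2" j]
    by (simp add: F_def v mult.assoc power2_eq_square power3_eq_cube mult.left_commute power_add)
  \<comment> \<open>The same product is peeled at its last and at its first factor; this trades G,
    the denominator of \<open>odd_mixed\<close> at k - 1, for F.\<close>
  have "G * (1 - A * B * q * v^2) = qpoch (A * B * q ^ (2 * j + 1)) (q^2) (Suc j)"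
    by (simp add: G_def qpoch_Suc v power2_eq_square[of v] flip: v_def)
  also have "\<dots> = (1 - A * B * q * v) * F"
    using D1 Suc by simp
  finally have G': "1 / G = (1 - A * B * q * v^2) / ((1 - A * B * q * v) * F)"
    using d F G by (simp add: field_simps)
  have D2: "qpoch (A * B * q ^ (2 * k + 1)) (q^2) k = F * (1 - A * B * q^3 * v^2)"
  proof -
    have "A * B * q ^ (2 * j + 3) * (q^2) ^ j = A * B * q^3 * v^2"
      by (simp add: power_add v power2_eq_square[of v] flip: v_def)
    moreover have "2 * k + 1 = 2 * j + 3" using Suc by simp
    ultimately show ?thesis using Suc by (simp only: F_def qpoch_Suc)
  qed
  have D3: "qpoch (A * B * q) (q^2) (Suc m + k) = E * (1 - A * B * q^3 * u * v)"
    "qpoch (A * B * q) (q^2) (m + k + 1) = E * (1 - A * B * q^3 * u * v)"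
  proof -
    have "A * B * q * (q^2) ^ (m + k) = A * B * q^3 * u * v"
      using Suc by (simp add: power_add power2_eq_square[of q] power3_eq_cube u_def v_def)
    then show "qpoch (A * B * q) (q^2) (Suc m + k) = E * (1 - A * B * q^3 * u * v)"
      "qpoch (A * B * q) (q^2) (m + k + 1) = E * (1 - A * B * q^3 * u * v)"
      by (simp_all add: E_def qpoch_Suc)
  qed
  have 1: "even_mixed A B q (Suc m) k = C * (A * (u * q^2 - 1) * v * (1 - A * B * u) * (1 + A * u) * (1 + A * q * u)
     / ((1 - A * B * q * v) * (1 - A * B * q^3 * u * v)))"
    unfolding even_mixed_def D1 D3 C_def
    using Suc by (simp add: qpoch_Suc[of "A * B"] qpoch_Suc[of "-A"] qpoch_Suc[of "-B"] qfall_Suc_Suc u v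
        flip: u_def v_def; simp add: mult_ac)
  have 2: "even_mixed A B q m k = C * (A * (u - v) / (1 - A * B * q * v))"
    unfolding even_mixed_def D1 C_def E_def[symmetric]
    using Suc by (simp add: qpoch_Suc[of "-B"] qfall_Suc u v
        flip: u_def v_def; simp add: mult_ac)
  have 3: "odd_mixed A B q m k = C * (A * (u - v) * (1 + A * u) * (1 - q^3 * v) * (1 + B * q^2 * v)
     / ((1 - A * B * q^3 * v^2) * (1 - A * B * q^3 * u * v)))"
    unfolding odd_mixed_def D2 D3 C_def
    using Suc by (simp add: qpoch_Suc[of "-A"] qpoch_Suc[of "-B"] qpoch_Suc[of q] qfall_Suc u v
        flip: u_def v_def; simp add: eval_nat_numeral mult_ac)
  have "odd_mixed A B q m j = A ^ j * qfall (q^2) m j * qpoch (A * B) (q^2) m * qpoch (- A) q (2 * m) * (1 + A * u)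
     * qpoch q (q^2) k * qpoch (- B) q (2 * j) * (1 + B * v) / E * (1 / G)"
    unfolding odd_mixed_def G_def[symmetric]
    using Suc by (simp add: qpoch_Suc[of "-A"] qpoch_Suc[of "-B"] E_def u v; simp add: mult_ac)
  then have 4: "even_lambda A B q (2 * k) * odd_mixed A B q m j = C * ((1 + A * u) * (1 - q^2 * v) * (1 + A * q * v) * (1 - A * B * v)
     / ((1 - A * B * q * v) * (1 - A * B * q^3 * v^2)))"
    unfolding G'
    using Suc even_lambda_even[of j] d by (simp add: C_def
        flip: u_def v_def; simp add: mult_ac)
  have 5: "A * (u * q^2 - 1) * v * (1 - A * B * u) * (1 + A * u) * (1 + A * q * u)
     / ((1 - A * B * q * v) * (1 - A * B * q^3 * u * v)) =
      (1 + A * u)^2 * (A * (u - v) / (1 - A * B * q * v)) - A * u *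
     (A * (u - v) * (1 + A * u) * (1 - q^3 * v) * (1 + B * q^2 * v)
     / ((1 - A * B * q^3 * v^2) * (1 - A * B * q^3 * u * v)) +
     (1 + A * u) * (1 - q^2 * v) * (1 + A * q * v) * (1 - A * B * v)
     / ((1 - A * B * q * v) * (1 - A * B * q^3 * v^2)))"
    using d by (simp add: divide_simps) algebra
  have k: "k - 1 = j" "(k = 0) = False" using Suc by auto
  show ?thesis unfolding u_def[symmetric] k if_False 4 unfolding 1 2 3 5
    by (simp only: right_diff_distrib distrib_left mult_ac)
qed

end

subsection \<open>Moments of the basis polynomials\<close>

text \<open>At b = -a, d = -c the sum A_n + C_n collapses to a + 1/a.\<close>

lemma aw_b_zero:
  fixes a c q :: "'a::field_char_0"
  assumes "a \<noteq> 0" and nz: "\<And>k. a^2 * c^2 * q ^ k \<noteq> 1"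
  shows "aw_b a (-a) c (-c) q n = 0"
proof (cases n)
  case 0
  have "1 - a * a * c * c \<noteq> 0"
    using nz[of 0] by (simp add: power2_eq_square mult_ac)
  then show ?thesis
    using \<open>a \<noteq> 0\<close> 0 by (simp add: aw_b_def aw_A_def aw_C_def divide_simps; simp add: algebra_simps)
next
  case (Suc m)
  define v where "v = q ^ m"
  have v: "q ^ (2 * m) = v^2" by (simp add: v_def power_mult mult.commute)
  have "1 - a * a * c * c * v^2 \<noteq> 0" "1 - a * a * c * c * (q * v^2) \<noteq> 0" "1 - a * a * c * c * (q * (q * v^2)) \<noteq> 0"
    using nz[of "2 * m"] nz[of "2 * m + 1"] nz[of "2 * m + 2"]
    by (auto simp: power2_eq_square[of a] power2_eq_square[of c] power2_eq_square[of q] power_add v mult.assoc)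
  then show ?thesis
    using \<open>a \<noteq> 0\<close> Suc
    by (simp add: aw_b_def aw_A_def aw_C_def v flip: v_def) (simp add: divide_simps; simp add: algebra_simps power2_eq_square)
qed

text \<open>In A_(n-1) C_n the factors 1 - a c q^(n-1) and 1 + a c q^(n-1) each occur twice in the
  numerator and cancel the two copies of 1 - a^2 c^2 q^(2n-2). For n = 1 the cancelled form of A_0
  is used.\<close>

lemma aw_lambda_even:
  fixes a c q :: "'a::field_char_0"
  assumes "a \<noteq> 0" and nz: "\<And>k. a^2 * c^2 * q ^ k \<noteq> 1" and "n > 0"
  shows "4 * aw_lambda a (-a) c (-c) q n = even_lambda (a^2) (c^2) q n"
proof -
  consider "n = 1" | m where "n = Suc (Suc m)"
    using \<open>n > 0\<close> by (metis One_nat_def gr0_conv_Suc not0_implies_Suc)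
  then show ?thesis
  proof cases
    case 1
    have "1 - a * (- a) * c * (- c) = (1 - a * c) * (1 + a * c)" by (simp add: algebra_simps)
    moreover have "a * (- a) * c * (- c) \<noteq> 1"
      using nz[of 0] by (simp add: power2_eq_square mult_ac)
    ultimately have e: "1 - a * (- a) * c * (- c) = (1 - a * c) * (1 + a * c)" "1 - a * c \<noteq> 0" "1 + a * c \<noteq> 0"
      by auto
    have A: "aw_A a (-a) c (-c) q 0 = (1 + a^2) / a"
      using e(2,3) unfolding aw_A_def e(1) by (simp add: power2_eq_square)
    have C: "aw_C a (-a) c (-c) q 1 = a * (1 - q) * (1 + c^2) / (1 - a^2 * c^2 * q)"
    proof -
      have "1 - a * (a * (c * c)) = (1 - a * c) * (1 + a * c)" by (simp add: algebra_simps)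
      then show ?thesis
        using e(2,3) unfolding aw_C_def by (simp add: power2_eq_square mult.assoc)
    qed
    show ?thesis
    proof -
      have "4 * aw_lambda a (-a) c (-c) q n = aw_A a (-a) c (-c) q 0 * aw_C a (-a) c (-c) q 1"
        using 1 by (simp add: aw_lambda_def)
      then show ?thesis
        unfolding A C using \<open>a \<noteq> 0\<close> 1 by (simp add: even_lambda_def; simp add: mult_ac)
    qed
  next
    case 2
    define v where "v = q ^ m"
    have v: "q ^ (2 * m) = v^2" "q ^ (m * 2) = v^2" by (simp_all add: v_def power_mult mult.commute)
    have d: "1 - a^2 * c^2 * v^2 * q \<noteq> 0" "1 - a^2 * c^2 * v^2 * q^2 \<noteq> 0" "1 - a^2 * c^2 * v^2 * q^3 \<noteq> 0"
      using nz[of "2 * m + 1"] nz[of "2 * m + 2"] nz[of "2 * m + 3"]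
      by (simp_all add: power2_eq_square[of q] power3_eq_cube power_add v mult_ac)
    define x where "x = 1 - a * c * q * v"
    define y where "y = 1 + a * c * q * v"
    have xy: "1 - a^2 * c^2 * (v^2 * q^2) = x * y"
      unfolding x_def y_def by (simp add: algebra_simps power2_eq_square)
    have "x \<noteq> 0" "y \<noteq> 0" using d(2) xy by (auto simp: mult.assoc)
    have f: "1 - a * (- a) * q ^ Suc m = 1 + a^2 * q * v" "1 - a * c * q ^ Suc m = x" "1 - a * (- c) * q ^ Suc m = y"
      "1 - (- a) * c * q ^ Suc m = y" "1 - (- a) * (- c) * q ^ Suc m = x" "1 - c * (- c) * q ^ Suc m = 1 + c^2 * q * v"
      "1 - q ^ Suc (Suc m) = 1 - q^2 * v"
      by (simp_all add: x_def y_def v_def power2_eq_square)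
    have g: "1 - a * (- a) * c * (- c) * q ^ k = 1 - a^2 * c^2 * q ^ k" for k
      by (simp add: power2_eq_square)
    have h: "q ^ (2 * m + 1) = v^2 * q" "q ^ (2 * m + 2) = v^2 * q^2" "q ^ (2 * m + 3) = v^2 * q^3"
      by (simp_all add: power_add v mult.commute power2_eq_square[of q] power3_eq_cube)
    have A: "aw_A a (-a) c (-c) q (Suc m) = (1 + a^2 * q * v) * (1 - a^2 * c^2 * v) / (a * (1 - a^2 * c^2 * v^2 * q))"
    proof -
      have e: "Suc m - 1 = m" "2 * Suc m - 1 = 2 * m + 1" "2 * Suc m = 2 * m + 2" "Suc m \<noteq> 0" by auto
      show ?thesis
        unfolding aw_A_def if_not_P[OF e(4)] e(1,2) unfolding e(3) f g unfolding h xy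
        using \<open>x \<noteq> 0\<close> \<open>y \<noteq> 0\<close> by (simp add: v_def flip: mult.assoc)
    qed
    have C: "aw_C a (-a) c (-c) q n = a * (1 - q^2 * v) * (1 + c^2 * q * v) / (1 - a^2 * c^2 * v^2 * q^3)"
    proof -
      have e: "n - 1 = Suc m" "2 * n - 2 = 2 * m + 2" "2 * n - 1 = 2 * m + 3" "n \<noteq> 0" using 2 by auto
      show ?thesis
        unfolding aw_C_def if_not_P[OF e(4)] e(1-3) unfolding 2 f g unfolding h xy
        using \<open>x \<noteq> 0\<close> \<open>y \<noteq> 0\<close> by (simp flip: mult.assoc)
    qed
    have e: "2 * n - 3 = 2 * m + 1" "2 * n - 1 = 2 * m + 3" "n - 1 = Suc m" using 2 by auto
    show ?thesis
      unfolding aw_lambda_def e even_lambda_def A C using 2 d(1,3) \<open>a \<noteq> 0\<close>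
      by (simp add: power_add v power2_eq_square[of q] flip: v_def) (simp add: mult_ac)
  qed
qed

text \<open>At x = cos t the i-th factor is 1 - 2 A p^i cos 2t + A^2 p^(2i), so the product is (A
  e^(2it); p)_m (A e^(-2it); p)_m, where the i in the exponents is the imaginary unit.\<close>

definition aw_basis :: "'a::field \<Rightarrow> 'a \<Rightarrow> nat \<Rightarrow> 'a poly" where
  "aw_basis A p m = (\<Prod>i<m. [:(1 + A * p ^ i)^2, 0, - 4 * (A * p ^ i):])"

lemma aw_basis_0 [simp]: "aw_basis A p 0 = 1"
  by (simp add: aw_basis_def)

lemma aw_basis_Suc:
  "aw_basis A p (Suc m) = smult ((1 + A * p ^ m)^2) (aw_basis A p m)
     - smult (4 * (A * p ^ m)) ([:0, 0, 1:] * aw_basis A p m)"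
  by (simp add: aw_basis_def algebra_simps)

section \<open>The functional on products of basis and Askey-Wilson polynomials\<close>

context
  fixes a c q :: "'a::field_char_0" and L :: "'a poly \<Rightarrow> 'a"
  assumes a: "a \<noteq> 0" and nz: "\<And>k. a^2 * c^2 * q ^ k \<noteq> 1"
    and L: "is_aw_functional a (-a) c (-c) q L"
begin

lemma even_functional_add: "L (p + r) = L p + L r"
  and even_functional_smult: "L (smult t p) = t * L p"
  and even_functional_1: "L 1 = 1"
  and even_functional_aw_poly: "n > 0 \<Longrightarrow> L (aw_poly a (-a) c (-c) q n) = 0"
  using L unfolding is_aw_functional_def linear_smult_times_iff by auto

lemma even_functional_minus: "L (- p) = - L p"
  using even_functional_smult[of "-1" p] by simp

lemma even_functional_diff: "L (p - r) = L p - L r"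
  using even_functional_add[of p "- r"] by (simp add: even_functional_minus)

lemma even_functional_0 [simp]: "L 0 = 0"
  using even_functional_smult[of 0 0] by simp

lemma even_functional_sum: "L (sum f S) = (\<Sum>i\<in>S. L (f i))"
  by (induction S rule: infinite_finite_induct) (simp_all add: even_functional_add)

lemma x_mult_aw_poly:
  "[:0, 1:] * aw_poly a (-a) c (-c) q n = aw_poly a (-a) c (-c) q (Suc n)
    + (if n = 0 then 0 else smult (aw_lambda a (-a) c (-c) q n) (aw_poly a (-a) c (-c) q (n - 1)))"
  by (cases n) (simp_all add: aw_b_zero[OF a nz])

lemma even_functional_shift:
  "L (r * ([:0, 1:] * aw_poly a (-a) c (-c) q n)) = L (r * aw_poly a (-a) c (-c) q (Suc n))
    + (if n = 0 then 0 else aw_lambda a (-a) c (-c) q n * L (r * aw_poly a (-a) c (-c) q (n - 1)))"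
  unfolding x_mult_aw_poly by (simp add: distrib_left even_functional_add even_functional_smult)

text \<open>Each x handed over to P_k moves k by one in either direction, so n + k stays odd; once n
  = 0, the index k is odd, hence positive, and L kills P_k.\<close>

lemma even_functional_parity: "odd (n + k) \<Longrightarrow> L (monom 1 n * aw_poly a (-a) c (-c) q k) = 0"
proof (induction n arbitrary: k)
  case 0
  then have "k > 0" by (auto intro: Nat.gr0I)
  with even_functional_aw_poly show ?case by (simp add: monom_0)
next
  case (Suc n)
  have "monom 1 (Suc n) = monom 1 n * [:0, 1::'a:]"
    by (simp add: monom_Suc)
  then have "L (monom 1 (Suc n) * aw_poly a (-a) c (-c) q k) = L (monom 1 n * ([:0, 1:] * aw_poly a (-a) c (-c) q k))"
    by (simp only: mult.assoc)
  also have "\<dots> = 0"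
    using Suc.IH[of "Suc k"] Suc.IH[of "k - 1"] Suc.prems by (subst even_functional_shift) (cases k; simp)
  finally show ?case .
qed

lemma even_functional_monom_odd: "L (monom 1 (2 * n + 1)) = 0"
  using even_functional_parity[of "2 * n + 1" 0] by simp

text \<open>Induction on m for all k at once, since the step at k draws on the indices k - 1, k and
  k + 1.\<close>

lemma even_functional_aw_basis_even:
  "4 ^ k * L (aw_basis (a^2) (q^2) m * aw_poly a (-a) c (-c) q (2 * k)) = even_mixed (a^2) (c^2) q m k"
proof (induction m arbitrary: k)
  case 0
  show ?case
  proof (cases k)
    case 0
    then show ?thesis by (simp add: even_functional_1 even_mixed_def)
  next
    case (Suc j)
    then show ?thesis
      using even_functional_aw_poly[of "2 * k"] by (simp add: even_mixed_def qfall_zero_left)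
  qed
next
  case (Suc m)
  let ?P = "aw_poly a (-a) c (-c) q" and ?\<Phi> = "aw_basis (a^2) (q^2) m"
  \<comment> \<open>The odd family at the same m: one x applied to P_(2k+1) leads back to the even
    indices of the induction hypothesis.\<close>
  have odd: "4 ^ Suc k * L (?\<Phi> * ([:0, 1:] * ?P (2 * k + 1))) = odd_mixed (a^2) (c^2) q m k" for k
  proof -
    have "4 ^ Suc k * L (?\<Phi> * ([:0, 1:] * ?P (2 * k + 1))) = 4 ^ Suc k * L (?\<Phi> * ?P (2 * Suc k))
       + (4 * aw_lambda a (-a) c (-c) q (2 * k + 1)) * (4 ^ k * L (?\<Phi> * ?P (2 * k)))"
      by (subst even_functional_shift) (simp add: algebra_simps)
    also have "\<dots> = odd_mixed (a^2) (c^2) q m k"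
      unfolding Suc.IH by (subst aw_lambda_even[OF a nz]) (simp_all add: odd_mixed_eq[OF nz])
    finally show ?thesis .
  qed
  \<comment> \<open>x^2 is split so that one x acts on P_(2k) and the other remains to form the odd
    family.\<close>
  have "[:0, 0, 1:] = [:0, 1:] * [:0, 1::'a:]" by simp
  then have "L ([:0, 0, 1:] * ?\<Phi> * ?P (2 * k)) = L (([:0, 1:] * ?\<Phi>) * ([:0, 1:] * ?P (2 * k)))"
    by (simp only: mult_ac)
  also have "\<dots> = L (?\<Phi> * ([:0, 1:] * ?P (2 * k + 1)))
      + (if k = 0 then 0 else aw_lambda a (-a) c (-c) q (2 * k) * L (?\<Phi> * ([:0, 1:] * ?P (2 * k - 1))))"
    by (subst even_functional_shift) (simp only: mult_ac mult_eq_0_iff, simp)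
  also have "4 ^ Suc k * \<dots> = odd_mixed (a^2) (c^2) q m k
      + (if k = 0 then 0 else even_lambda (a^2) (c^2) q (2 * k) * odd_mixed (a^2) (c^2) q m (k - 1))"
  proof (cases "k = 0")
    case True
    then show ?thesis using odd[of k] by simp
  next
    case False
    then have "2 * (k - 1) + 1 = 2 * k - 1" "Suc (k - 1) = k" by auto
    then have 1: "4 ^ k * L (?\<Phi> * ([:0, 1:] * ?P (2 * k - 1))) = odd_mixed (a^2) (c^2) q m (k - 1)"
      using odd[of "k - 1"] by metis
    have 2: "4 ^ Suc k * (X + l * Y) = 4 ^ Suc k * X + 4 * l * (4 ^ k * Y)" for X Y l :: 'a
      by (simp add: algebra_simps)
    show ?thesis
      using False unfolding if_not_P[OF False] 2 1 odd by (subst aw_lambda_even[OF a nz]) simp_all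
  qed
  finally have *: "4 ^ Suc k * L ([:0, 0, 1:] * ?\<Phi> * ?P (2 * k)) = \<dots>" .
  \<comment> \<open>The 4 in \<open>aw_basis_Suc\<close> raises 4^k to the 4^(k+1) of the odd
    family.\<close>
  have "4 ^ k * L (aw_basis (a^2) (q^2) (Suc m) * ?P (2 * k)) =
     (1 + a^2 * (q^2) ^ m)^2 * (4 ^ k * L (?\<Phi> * ?P (2 * k)))
      - a^2 * (q^2) ^ m * (4 ^ Suc k * L ([:0, 0, 1:] * ?\<Phi> * ?P (2 * k)))"
    unfolding aw_basis_Suc left_diff_distrib mult_smult_left even_functional_diff even_functional_smult by (simp add: algebra_simps)
  also have "\<dots> = even_mixed (a^2) (c^2) q (Suc m) k"
    unfolding * Suc.IH even_mixed_Suc[OF nz] ..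
  finally show ?case .
qed

lemma even_functional_aw_basis:
  "L (aw_basis (a^2) (q^2) m) =
     qpoch (- (a^2)) q (2 * m) * qpoch (a^2 * c^2) (q^2) m / qpoch (q * a^2 * c^2) (q^2) m"
  using even_functional_aw_basis_even[of 0 m] by (simp add: even_mixed_def mult_ac)

end

subsection \<open>Chebyshev expansion of powers\<close>

text \<open>This is U_n(w/2): for w = 2 cos s it equals sin((n+1)s) / sin s. A commutative ring is
  allowed so that w can be a polynomial.\<close>

fun cheb :: "'a::comm_ring_1 \<Rightarrow> nat \<Rightarrow> 'a" where
  "cheb w 0 = 1"
| "cheb w (Suc 0) = w"
| "cheb w (Suc (Suc n)) = w * cheb w (Suc n) - cheb w n"

text \<open>Ballot numbers, taken in the integers because they turn negative past the middle of the
  row.\<close>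

definition ballot :: "nat \<Rightarrow> nat \<Rightarrow> int" where
  "ballot n s = int (n choose s) - (if s = 0 then 0 else int (n choose (s - 1)))"

lemma ballot_0 [simp]: "ballot n 0 = 1"
  by (simp add: ballot_def)

lemma ballot_Suc: "ballot (Suc n) (Suc s) = ballot n (Suc s) + ballot n s"
  by (cases s) (simp_all add: ballot_def)

lemma ballot_middle: "ballot (2 * n + 1) (Suc n) = 0"
  using binomial_symmetric[of n "2 * n + 1"] by (simp add: ballot_def)

text \<open>Since (w + 2) U_N = U_(N+1) + 2 U_N + U_(N-1), multiplying by w + 2 amounts to two
  Pascal steps, from row 2n + 1 to row 2n + 3.\<close>

lemma power_eq_sum_cheb:
  fixes w :: "'a::comm_ring_1"
  shows "(w + 2) ^ n = (\<Sum>s\<le>n. of_int (ballot (2 * n + 1) s) * cheb w (n - s))"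
proof (induction n)
  case (Suc n)
  let ?b = "\<lambda>s. of_int (ballot (2 * n + 1) s) :: 'a"
  (* Shifted by one, so that U 0 = 0 is the Chebyshev polynomial of index -1. *)
  define U where "U i = (if i = 0 then 0 else cheb w (i - 1))" for i
  have U: "w * U (Suc i) = U (Suc (Suc i)) + U i" for i
    by (cases i) (simp_all add: U_def)
  \<comment> \<open>Pascal's rule on the level of sums: raising the row adds a copy with s moved by
    one.\<close>
  have shift: "(\<Sum>s\<le>Suc n. of_int (ballot (Suc m) s) * U (Suc (Suc n) - s)) =
     (\<Sum>s\<le>Suc n. of_int (ballot m s) * U (Suc (Suc n) - s)) + (\<Sum>s\<le>n. of_int (ballot m s) * U (Suc n - s))" for m
    by (simp add: sum.atMost_Suc_shift ballot_Suc sum.distrib distrib_right add_ac del: sum.atMost_Suc)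
  have m: "?b (Suc n) = 0" by (simp add: ballot_middle del: One_nat_def)
  have "(w + 2) ^ Suc n = (\<Sum>s\<le>n. ?b s * ((w + 2) * U (Suc (n - s))))"
    using Suc.IH by (simp add: U_def sum_distrib_left mult_ac)
  also have "\<dots> = (\<Sum>s\<le>n. ?b s * U (Suc (Suc (n - s)))) + 2 * (\<Sum>s\<le>n. ?b s * U (Suc (n - s))) + (\<Sum>s\<le>n. ?b s * U (n - s))"
    unfolding distrib_right U by (simp add: algebra_simps sum.distrib sum_distrib_left)
  also have "(\<Sum>s\<le>n. ?b s * U (Suc (Suc (n - s)))) = (\<Sum>s\<le>n. ?b s * U (Suc (Suc n) - s))"
    by (intro sum.cong) (auto simp: Suc_diff_le)
  \<comment> \<open>The term s = n + 1 may be added because the two middle binomials of row 2n + 1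
    are equal.\<close>
  also have "\<dots> = (\<Sum>s\<le>Suc n. ?b s * U (Suc (Suc n) - s))"
    using m by simp
  also have "(\<Sum>s\<le>n. ?b s * U (Suc (n - s))) = (\<Sum>s\<le>n. ?b s * U (Suc n - s))"
    by (intro sum.cong) (auto simp: Suc_diff_le)
  also have "(\<Sum>s\<le>Suc n. ?b s * U (Suc (Suc n) - s)) + 2 * (\<Sum>s\<le>n. ?b s * U (Suc n - s)) + (\<Sum>s\<le>n. ?b s * U (n - s))
    = (\<Sum>s\<le>Suc n. of_int (ballot (2 * n + 2) s) * U (Suc (Suc n) - s)) + (\<Sum>s\<le>n. of_int (ballot (2 * n + 2) s) * U (Suc n - s))"
  proof -
    have "(\<Sum>s\<le>n. of_int (ballot (2 * n + 2) s) * U (Suc n - s)) = (\<Sum>s\<le>n. ?b s * U (Suc n - s)) + (\<Sum>s\<le>n. ?b s * U (n - s))"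
    proof (cases n)
      case (Suc k)
      \<comment> \<open>The last sum may stop at k because its term s = n carries U 0 = 0.\<close>
      have "(\<Sum>s\<le>Suc k. of_int (ballot (2 * n + 2) s) * U (Suc n - s)) =
        (\<Sum>s\<le>Suc k. ?b s * U (Suc n - s)) + (\<Sum>s\<le>k. ?b s * U (n - s))"
        unfolding Suc
        by (simp add: sum.atMost_Suc_shift ballot_Suc sum.distrib distrib_right add_ac del: sum.atMost_Suc)
      then show ?thesis by (simp add: Suc U_def)
    qed (simp add: U_def)
    then show ?thesis using shift[of "2 * n + 1"] by simp
  qed
  also have "\<dots> = (\<Sum>s\<le>Suc n. of_int (ballot (2 * n + 3) s) * U (Suc (Suc n) - s))"
    using shift[of "2 * n + 2"] by (simp add: eval_nat_numeral)
  also have "\<dots> = (\<Sum>s\<le>Suc n. of_int (ballot (2 * Suc n + 1) s) * cheb w (Suc n - s))"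
    by (intro sum.cong) (auto simp: U_def eval_nat_numeral Suc_diff_le)
  finally show ?case .
qed simp

section \<open>The q-Pascal rules\<close>

context
  fixes p :: "'a::field"
  assumes p: "\<And>k. p ^ Suc k \<noteq> 1"
begin

lemma qpoch_self_nonzero: "qpoch p p n \<noteq> 0"
proof (rule qpoch_nonzero)
  fix i show "p * p ^ i \<noteq> 1" using p[of i] by simp
qed

lemma qbinom_self: "qbinom p m m = 1"
  by (simp_all add: qpoch_self_nonzero qbinom_def)

lemma qbinom_pascal:
  "qbinom p (Suc m + Suc r) (Suc m) = p ^ Suc m * qbinom p (Suc m + r) (Suc m) + qbinom p (m + Suc r) m"
  "qbinom p (Suc m + Suc r) (Suc m) = qbinom p (Suc m + r) (Suc m) + p ^ Suc r * qbinom p (m + Suc r) m"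
proof -
  have nz: "qpoch p p m \<noteq> 0" "qpoch p p r \<noteq> 0" "1 - p * p ^ m \<noteq> 0" "1 - p * p ^ r \<noteq> 0"
    using qpoch_self_nonzero p[of m] p[of r] by auto
  show "qbinom p (Suc m + Suc r) (Suc m) = p ^ Suc m * qbinom p (Suc m + r) (Suc m) + qbinom p (m + Suc r) m"
    "qbinom p (Suc m + Suc r) (Suc m) = qbinom p (Suc m + r) (Suc m) + p ^ Suc r * qbinom p (m + Suc r) m"
    using nz by (simp_all add: qbinom_def qpoch_Suc power_add divide_simps) algebra+
qed

end

text \<open>Generating functions in $r$ of the complete homogeneous polynomials $h_r$ in
  $A, Ap, \ldots, Ap^m$ and in the inverses of these.\<close>

definition complete_fps :: "'a::field \<Rightarrow> 'a \<Rightarrow> nat \<Rightarrow> 'a fps" where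
  "complete_fps A p m = Abs_fps (\<lambda>r. A ^ r * qbinom p (m + r) m)"

definition complete_inv_fps :: "'a::field \<Rightarrow> 'a \<Rightarrow> nat \<Rightarrow> 'a fps" where
  "complete_inv_fps A p m = Abs_fps (\<lambda>r. qbinom p (m + r) m / (A * p ^ m) ^ r)"

text \<open>The generating function in N of the coefficient of Phi_m in U_N(cos 2t). For A, p
  nonzero and p not a root of unity it is the product of -X / (A p^i) over i < m, divided by the
  product of 1 - (A p^i + 1/(A p^i)) X + X^2 over i \<le> m.\<close>

definition cheb_coeff_fps :: "'a::field \<Rightarrow> 'a \<Rightarrow> nat \<Rightarrow> 'a fps" where
  "cheb_coeff_fps A p m = fps_const (\<Prod>i<m. - 1 / (A * p ^ i)) * fps_X ^ m * complete_fps A p m * complete_inv_fps A p m"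

lemma quad_factor:
  fixes x :: "'a::field"
  assumes "x \<noteq> 0"
  shows "1 - fps_const (x + 1 / x) * fps_X + fps_X^2 = (1 - fps_const x * fps_X) * (1 - fps_const (1 / x) * fps_X)"
proof -
  have "fps_const x * fps_const (1 / x) = 1" using assms by simp
  then have "fps_const x * fps_X * (fps_const (1 / x) * fps_X) = fps_X^2"
    by (metis (no_types, lifting) mult.assoc mult.left_commute mult_1 power2_eq_square)
  then show ?thesis by (simp add: algebra_simps flip: fps_const_add)
qed

lemma quad_nth:
  fixes b :: "'a::field"
  shows "fps_nth ((1 - fps_const b * fps_X + fps_X^2) * f) n = fps_nth f n
    - (if n = 0 then 0 else b * fps_nth f (n - 1)) + (if n < 2 then 0 else fps_nth f (n - 2))"
  by (simp add: distrib_right left_diff_distrib mult.assoc fps_X_power_mult_nth)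

lemma cheb_coeff_fps_nth_above: "N < m \<Longrightarrow> fps_nth (cheb_coeff_fps A p m) N = 0"
  by (simp add: cheb_coeff_fps_def mult.assoc fps_X_power_mult_nth)

lemma cheb_coeff_fps_nth:
  "fps_nth (cheb_coeff_fps A p m) N = (if N < m then 0 else (\<Prod>i<m. - 1 / (A * p ^ i)) *
     (\<Sum>r\<le>N - m. A ^ r * qbinom p (m + r) m * (qbinom p (N - r) m / (A * p ^ m) ^ (N - m - r))))"
proof (cases "N < m")
  case False
  then have "fps_nth (cheb_coeff_fps A p m) N = (\<Prod>i<m. - 1 / (A * p ^ i)) * fps_nth (complete_fps A p m * complete_inv_fps A p m) (N - m)"
    by (simp add: cheb_coeff_fps_def mult.assoc fps_X_power_mult_nth)
  also have "fps_nth (complete_fps A p m * complete_inv_fps A p m) (N - m) =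
     (\<Sum>r\<le>N - m. A ^ r * qbinom p (m + r) m * (qbinom p (N - r) m / (A * p ^ m) ^ (N - m - r)))"
    using False unfolding fps_mult_nth atLeast0AtMost complete_fps_def complete_inv_fps_def
    by (intro sum.cong) auto
  finally show ?thesis using False by simp
qed (simp add: cheb_coeff_fps_nth_above)

section \<open>Functional equations of the generating functions\<close>

context
  fixes A p :: "'a::field"
  assumes p: "\<And>k. p ^ Suc k \<noteq> 1" and A0: "A \<noteq> 0" and p0: "p \<noteq> 0"
begin

lemma complete_fps_0: "(1 - fps_const A * fps_X) * complete_fps A p 0 = 1"
proof (rule fps_ext)
  fix n show "fps_nth ((1 - fps_const A * fps_X) * complete_fps A p 0) n = fps_nth 1 n"
    by (cases n) (simp_all add: complete_fps_def qbinom_def left_diff_distrib mult.assoc qpoch_self_nonzero[OF p])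
qed

lemma complete_inv_fps_0: "(1 - fps_const (1 / A) * fps_X) * complete_inv_fps A p 0 = 1"
proof (rule fps_ext)
  fix n show "fps_nth ((1 - fps_const (1 / A) * fps_X) * complete_inv_fps A p 0) n = fps_nth 1 n"
    by (cases n) (simp_all add: complete_inv_fps_def qbinom_def left_diff_distrib mult.assoc qpoch_self_nonzero[OF p])
qed

text \<open>Adjoining the variable A p^(m+1) divides the generating function by one linear factor;
  on coefficients this is the first q-Pascal rule.\<close>

lemma complete_fps_Suc: "(1 - fps_const (A * p ^ Suc m) * fps_X) * complete_fps A p (Suc m) = complete_fps A p m"
proof (rule fps_ext)
  fix n show "fps_nth ((1 - fps_const (A * p ^ Suc m) * fps_X) * complete_fps A p (Suc m)) n = fps_nth (complete_fps A p m) n"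
  proof (cases n)
    case 0
    show ?thesis unfolding 0 using qbinom_self[OF p] by (simp add: complete_fps_def left_diff_distrib)
  next
    case (Suc r)
    have "fps_nth ((1 - fps_const (A * p ^ Suc m) * fps_X) * complete_fps A p (Suc m)) n =
      A ^ Suc r * qbinom p (Suc m + Suc r) (Suc m) - A * p ^ Suc m * (A ^ r * qbinom p (Suc m + r) (Suc m))"
      unfolding Suc by (simp add: complete_fps_def left_diff_distrib mult.assoc)
    also have "\<dots> = A ^ Suc r * qbinom p (m + Suc r) m"
      unfolding qbinom_pascal(1)[OF p] by (simp add: algebra_simps)
    finally show ?thesis by (simp add: complete_fps_def Suc)
  qed
qed

text \<open>Here the second q-Pascal rule fits: its power p^(r+1) turns the denominator (A
  p^(m+1))^(r+1) into (A p^m)^(r+1).\<close>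

lemma complete_inv_fps_Suc: "(1 - fps_const (1 / (A * p ^ Suc m)) * fps_X) * complete_inv_fps A p (Suc m) = complete_inv_fps A p m"
proof (rule fps_ext)
  fix n show "fps_nth ((1 - fps_const (1 / (A * p ^ Suc m)) * fps_X) * complete_inv_fps A p (Suc m)) n = fps_nth (complete_inv_fps A p m) n"
  proof (cases n)
    case 0
    show ?thesis unfolding 0 using qbinom_self[OF p] by (simp add: complete_inv_fps_def left_diff_distrib)
  next
    case (Suc r)
    have "fps_nth ((1 - fps_const (1 / (A * p ^ Suc m)) * fps_X) * complete_inv_fps A p (Suc m)) n =
      qbinom p (Suc m + Suc r) (Suc m) / (A * p ^ Suc m) ^ Suc r - 1 / (A * p ^ Suc m) * (qbinom p (Suc m + r) (Suc m) / (A * p ^ Suc m) ^ r)"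
      unfolding Suc by (simp add: complete_inv_fps_def left_diff_distrib mult.assoc)
    also have "\<dots> = p ^ Suc r * qbinom p (m + Suc r) m / (A * p ^ Suc m) ^ Suc r"
      unfolding qbinom_pascal(2)[OF p] by (simp add: add_divide_distrib)
    also have "(A * p ^ Suc m) ^ Suc r = p ^ Suc r * (A * p ^ m) ^ Suc r"
      by (simp add: power_mult_distrib mult_ac)
    finally show ?thesis using p0 by (simp add: complete_inv_fps_def Suc)
  qed
qed

lemma cheb_coeff_fps_0: "(1 - fps_const (A + 1 / A) * fps_X + fps_X^2) * cheb_coeff_fps A p 0 = 1"
proof -
  have "(1 - fps_const (A + 1 / A) * fps_X + fps_X^2) * cheb_coeff_fps A p 0 =
     ((1 - fps_const A * fps_X) * complete_fps A p 0) * ((1 - fps_const (1 / A) * fps_X) * complete_inv_fps A p 0)"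
    unfolding quad_factor[OF A0] cheb_coeff_fps_def by (simp add: mult_ac)
  then show ?thesis unfolding complete_fps_0 complete_inv_fps_0 by simp
qed

text \<open>Each half of \<open>quad_factor\<close> lowers m in one of the two series. On
  coefficients this is the recurrence that multiplication by 2 cos 2t imposes.\<close>

lemma cheb_coeff_fps_Suc:
  "(1 - fps_const (A * p ^ Suc m + 1 / (A * p ^ Suc m)) * fps_X + fps_X^2) * cheb_coeff_fps A p (Suc m)
     = fps_const (- 1 / (A * p ^ m)) * fps_X * cheb_coeff_fps A p m"
proof -
  have nz: "A * p ^ Suc m \<noteq> 0" using A0 p0 by simp
  have "(1 - fps_const (A * p ^ Suc m + 1 / (A * p ^ Suc m)) * fps_X + fps_X^2) * cheb_coeff_fps A p (Suc m)
    = fps_const (\<Prod>i<Suc m. - 1 / (A * p ^ i)) * fps_X ^ Suc m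
      * ((1 - fps_const (A * p ^ Suc m) * fps_X) * complete_fps A p (Suc m))
      * ((1 - fps_const (1 / (A * p ^ Suc m)) * fps_X) * complete_inv_fps A p (Suc m))"
    unfolding quad_factor[OF nz] cheb_coeff_fps_def by (simp only: mult_ac)
  also have "\<dots> = fps_const (- 1 / (A * p ^ m)) * fps_X * cheb_coeff_fps A p m"
    unfolding complete_fps_Suc complete_inv_fps_Suc cheb_coeff_fps_def by (simp only: mult_ac prod.lessThan_Suc power_Suc flip: fps_const_mult)
  finally show ?thesis .
qed

end

subsection \<open>Expansion in the basis polynomials\<close>

text \<open>The polynomial 4 x^2 - 2 is 2 cos 2t; the claim is \<open>aw_basis_Suc\<close> solved
  for x^2 Phi_m.\<close>

lemma aw_basis_mult_quadratic:
  fixes A p :: "'a::field"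
  assumes "A * p ^ m \<noteq> 0"
  shows "[:- 2, 0, 4:] * aw_basis A p m
    = smult (A * p ^ m + 1 / (A * p ^ m)) (aw_basis A p m) - smult (1 / (A * p ^ m)) (aw_basis A p (Suc m))"
proof -
  define x where "x = A * p ^ m"
  let ?\<Phi> = "aw_basis A p m"
  have x: "x \<noteq> 0" using assms by (simp add: x_def)
  have "[:- 2, 0, 4:] = smult 4 [:0, 0, 1:] - [:2::'a:]" by simp
  then have "[:- 2, 0, 4:] * ?\<Phi> = smult 4 ([:0, 0, 1:] * ?\<Phi>) - smult 2 ?\<Phi>"
    by (simp only: left_diff_distrib mult_smult_left) simp
  also have "smult 4 ([:0, 0, 1:] * ?\<Phi>) = smult (1 / x) (smult (4 * x) ([:0, 0, 1:] * ?\<Phi>))"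
    using x by simp
  also have "smult (4 * x) ([:0, 0, 1:] * ?\<Phi>) = smult ((1 + x)^2) ?\<Phi> - aw_basis A p (Suc m)"
    unfolding aw_basis_Suc x_def[symmetric] by simp
  also have "smult (1 / x) (smult ((1 + x)^2) ?\<Phi> - aw_basis A p (Suc m)) - smult 2 ?\<Phi>
      = smult (1 / x * (1 + x)^2 - 2) ?\<Phi> - smult (1 / x) (aw_basis A p (Suc m))"
    by (simp add: smult_diff_right smult_diff_left)
  also have "1 / x * (1 + x)^2 - 2 = x + 1 / x"
    using x by (simp add: field_simps power2_eq_square)
  finally show ?thesis by (simp add: x_def)
qed

text \<open>The bound M is free so that N, N + 1 and N + 2 share one range of summation in the
  induction; terms with m > N vanish.\<close>

lemma cheb_eq_sum_aw_basis:
  fixes A p :: "'a::field"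
  assumes p: "\<And>k. p ^ Suc k \<noteq> 1" and A0: "A \<noteq> 0" and p0: "p \<noteq> 0"
  shows "N \<le> M \<Longrightarrow> cheb [:- 2, 0, 4:] N = (\<Sum>m\<le>M. smult (fps_nth (cheb_coeff_fps A p m) N) (aw_basis A p m))"
proof (induction "[:- 2, 0, 4:] :: 'a poly" N arbitrary: M rule: cheb.induct)
  case 1
  have "(\<Sum>m\<le>M. smult (fps_nth (cheb_coeff_fps A p m) 0) (aw_basis A p m)) =
     (\<Sum>m\<in>{0}. smult (fps_nth (cheb_coeff_fps A p m) 0) (aw_basis A p m))"
    by (intro sum.mono_neutral_right) (auto simp: cheb_coeff_fps_nth_above)
  then show ?case by (simp add: cheb_coeff_fps_nth qbinom_def)
next
  case 2
  have b: "qbinom p 1 0 = 1" "qbinom p 1 1 = 1" "qbinom p 0 0 = 1"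
    using qpoch_self_nonzero[OF p] by (simp_all add: qbinom_def)
  have "(\<Sum>m\<le>M. smult (fps_nth (cheb_coeff_fps A p m) 1) (aw_basis A p m)) =
     (\<Sum>m\<in>{0,1}. smult (fps_nth (cheb_coeff_fps A p m) 1) (aw_basis A p m))"
    using 2 by (intro sum.mono_neutral_right) (auto simp: cheb_coeff_fps_nth_above)
  \<comment> \<open>The coefficients A + 1/A and -1/A are those of
    \<open>aw_basis_mult_quadratic\<close> at m = 0.\<close>
  also have "\<dots> = [:- 2, 0, 4:]"
    using A0 aw_basis_mult_quadratic[of A p 0] b by (simp add: cheb_coeff_fps_nth add.commute)
  finally show ?case by simp
next
  case (3 N)
  let ?g = "\<lambda>m. fps_nth (cheb_coeff_fps A p m)" and ?\<Phi> = "aw_basis A p" and ?\<beta> = "\<lambda>m. A * p ^ m + 1 / (A * p ^ m)"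
  obtain M' where M: "M = Suc M'" "N < M'" using 3 by (cases M) auto
  have g0: "?g 0 (Suc (Suc N)) = ?\<beta> 0 * ?g 0 (Suc N) - ?g 0 N"
    using cheb_coeff_fps_0[OF p A0 p0, THEN arg_cong, of "\<lambda>f. fps_nth f (Suc (Suc N))"]
    unfolding quad_nth by (simp add: algebra_simps)
  have gS: "?g (Suc m) (Suc (Suc N)) = ?\<beta> (Suc m) * ?g (Suc m) (Suc N) - ?g (Suc m) N - 1 / (A * p ^ m) * ?g m (Suc N)" for m
    using cheb_coeff_fps_Suc[OF p A0 p0, of m, THEN arg_cong, of "\<lambda>f. fps_nth f (Suc (Suc N))"]
    unfolding quad_nth mult.assoc fps_mult_left_const_nth by (simp add: algebra_simps)
  have N: "cheb [:- 2, 0, 4:] N = (\<Sum>m\<le>M. smult (?g m N) (?\<Phi> m))"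
    using 3 by simp
  have S: "cheb [:- 2, 0, 4:] (Suc N) = (\<Sum>m\<le>M. smult (?g m (Suc N)) (?\<Phi> m))"
    using 3 by simp
  have "[:- 2, 0, 4:] * cheb [:- 2, 0, 4:] (Suc N) = (\<Sum>m\<le>M. smult (?g m (Suc N)) ([:- 2, 0, 4:] * ?\<Phi> m))"
    unfolding S by (simp only: sum_distrib_left mult_smult_right)
  also have "\<dots> = (\<Sum>m\<le>M. smult (?\<beta> m * ?g m (Suc N)) (?\<Phi> m)) - (\<Sum>m\<le>M. smult (1 / (A * p ^ m) * ?g m (Suc N)) (?\<Phi> (Suc m)))"
  proof -
    have nz: "A * p ^ m \<noteq> 0" for m using A0 p0 by simp
    show ?thesis
      unfolding aw_basis_mult_quadratic[OF nz] by (simp only: smult_diff_right sum_subtractf smult_smult mult.commute)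
  qed
  \<comment> \<open>The top term drops out since N + 1 < M; otherwise Phi_(M+1) would
    appear.\<close>
  also have "(\<Sum>m\<le>M. smult (1 / (A * p ^ m) * ?g m (Suc N)) (?\<Phi> (Suc m))) =
      (\<Sum>m\<le>M'. smult (1 / (A * p ^ m) * ?g m (Suc N)) (?\<Phi> (Suc m)))"
    using M by (simp add: cheb_coeff_fps_nth_above)
  finally have *: "[:- 2, 0, 4:] * cheb [:- 2, 0, 4:] (Suc N) =
    (\<Sum>m\<le>M. smult (?\<beta> m * ?g m (Suc N)) (?\<Phi> m)) - (\<Sum>m\<le>M'. smult (1 / (A * p ^ m) * ?g m (Suc N)) (?\<Phi> (Suc m)))" .
  show ?case
    unfolding cheb.simps * N unfolding M sum.atMost_Suc_shift g0 gS
    by (simp add: smult_diff_left sum_subtractf)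
qed

section \<open>The expansion coefficients with integer powers of a and q\<close>

lemma prod_cheb_coeff:
  fixes a q :: "'a::field"
  assumes "a \<noteq> 0" "q \<noteq> 0"
  shows "(\<Prod>i<m. - 1 / (a^2 * (q^2) ^ i)) = (-1) ^ m * a powi (- 2 * int m) * q powi (- int m * (int m - 1))"
proof (induction m)
  case (Suc m)
  have "(q^2) ^ m = q powi (2 * int m)" "a^2 = a powi 2"
    by (simp_all add: power_int_def nat_mult_distrib power_mult)
  then have 1: "- 1 / (a^2 * (q^2) ^ m) = - 1 * (a powi (-2) * q powi (- 2 * int m))"
    by (simp add: power_int_minus divide_inverse)
  have 2: "a powi (- 2 * int m) * a powi (-2) = a powi (- 2 * int (Suc m))"
    using assms by (subst power_int_add[symmetric]) (auto simp: algebra_simps)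
  have 3: "q powi (- int m * (int m - 1)) * q powi (- 2 * int m) = q powi (- int (Suc m) * (int (Suc m) - 1))"
    using assms by (subst power_int_add[symmetric]) (auto simp: algebra_simps)
  have "(\<Prod>i<Suc m. - 1 / (a^2 * (q^2) ^ i)) = (- 1 * (- 1) ^ m) * (a powi (- 2 * int m) * a powi (-2))
      * (q powi (- int m * (int m - 1)) * q powi (- 2 * int m))"
    unfolding prod.lessThan_Suc Suc.IH 1 by (simp only: mult_ac)
  then show ?case
    unfolding 2 3 by simp
qed simp

text \<open>The convolution index of the two complete series becomes the p of the formula; the rest
  is collecting exponents.\<close>

lemma cheb_coeff_fps_nth_powi:
  fixes a q :: "'a::field"
  assumes p: "\<And>k. (q^2) ^ Suc k \<noteq> 1" and a0: "a \<noteq> 0" and q0: "q \<noteq> 0" and "s \<le> n"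
  shows "fps_nth (cheb_coeff_fps (a^2) (q^2) m) (n - s) = (- (q^2)) ^ m *
     (\<Sum>p | m + s + p \<le> n.
               a powi (- 2 * int n + 4 * int p + 2 * int s)
               * qbinom (q^2) (m + p) m * qbinom (q^2) (n - p - s) m
               * q powi (- 2 * int m * (int n - int p - int s) + int m * (int m - 1)))"
proof (cases "m + s \<le> n")
  case False
  then have "{p. m + s + p \<le> n} = {}" by auto
  with False \<open>s \<le> n\<close> show ?thesis by (simp add: cheb_coeff_fps_nth_above)
next
  case True
  then have set: "{p. m + s + p \<le> n} = {..n - s - m}" by auto
  have A0: "a^2 \<noteq> 0" "q^2 \<noteq> 0" using a0 q0 by auto
  have "(\<Prod>i<m. - 1 / (a^2 * (q^2) ^ i)) * ((a^2) ^ r * qbinom (q^2) (m + r) m *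
        (qbinom (q^2) (n - s - r) m / (a^2 * (q^2) ^ m) ^ (n - s - m - r))) =
     (- (q^2)) ^ m * (a powi (- 2 * int n + 4 * int r + 2 * int s)
               * qbinom (q^2) (m + r) m * qbinom (q^2) (n - r - s) m
               * q powi (- 2 * int m * (int n - int r - int s) + int m * (int m - 1)))"
    if "r \<le> n - s - m" for r
  proof -
    \<comment> \<open>t is the degree taken from the inverse series. The exponents are then 2r - 2m
      - 2t for a and -m(m-1) - 2mt for q, and q^(2m) is split off the latter to form
      \<open>(- (q^2)) ^ m\<close>.\<close>
    define t where "t = n - s - m - r"
    have t: "int t = int n - int s - int m - int r"
      using that True by (simp add: t_def)
    have 1: "(a^2) ^ r = a powi (2 * int r)"
      by (simp add: power_int_def nat_mult_distrib power_mult)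
    have 2: "1 / (a^2 * (q^2) ^ m) ^ t = a powi (- 2 * int t) * q powi (- 2 * int m * int t)"
    proof -
      have "(a^2 * (q^2) ^ m) ^ t = a powi (2 * int t) * q powi (2 * int m * int t)"
        by (simp add: power_int_def nat_mult_distrib power_mult_distrib flip: power_mult)
      then show ?thesis by (simp add: power_int_minus divide_inverse)
    qed
    have 3: "(- (q^2)) ^ m = (-1) ^ m * q powi (2 * int m)"
      by (subst power_minus) (simp add: power_int_def nat_mult_distrib power_mult)
    have "- 2 * int n + 4 * int r + 2 * int s = - 2 * int m + (2 * int r + (- 2 * int t))"
      by (simp add: t)
    then have 4: "a powi (- 2 * int n + 4 * int r + 2 * int s) = a powi (- 2 * int m) * (a powi (2 * int r) * a powi (- 2 * int t))"
      using a0 by (simp only: power_int_add simp_thms)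
    have "2 * int m + (- 2 * int m * (int n - int r - int s) + int m * (int m - 1)) = - int m * (int m - 1) + - 2 * int m * int t"
      by (simp add: t algebra_simps)
    then have 5: "q powi (2 * int m) * q powi (- 2 * int m * (int n - int r - int s) + int m * (int m - 1)) =
       q powi (- int m * (int m - 1)) * q powi (- 2 * int m * int t)"
      using q0 by (metis power_int_add)
    have "(\<Prod>i<m. - 1 / (a^2 * (q^2) ^ i)) * ((a^2) ^ r * qbinom (q^2) (m + r) m *
        (qbinom (q^2) (n - s - r) m / (a^2 * (q^2) ^ m) ^ t)) =
      (\<Prod>i<m. - 1 / (a^2 * (q^2) ^ i)) * ((a^2) ^ r * qbinom (q^2) (m + r) m *
        (qbinom (q^2) (n - r - s) m * (1 / (a^2 * (q^2) ^ m) ^ t)))"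
      by (simp add: add.commute)
    also have "\<dots> = (-1) ^ m * (a powi (- 2 * int m) * (a powi (2 * int r) * a powi (- 2 * int t)))
       * qbinom (q^2) (m + r) m * qbinom (q^2) (n - r - s) m
       * (q powi (- int m * (int m - 1)) * q powi (- 2 * int m * int t))"
      unfolding prod_cheb_coeff[OF a0 q0] 1 2 by (simp only: mult_ac)
    also have "\<dots> = (-1) ^ m * a powi (- 2 * int n + 4 * int r + 2 * int s)
       * qbinom (q^2) (m + r) m * qbinom (q^2) (n - r - s) m
       * (q powi (2 * int m) * q powi (- 2 * int m * (int n - int r - int s) + int m * (int m - 1)))"
      unfolding 4 5 ..
    finally show ?thesis unfolding 3 t_def by (simp only: mult_ac)
  qed
  then show ?thesis
    using True unfolding cheb_coeff_fps_nth set by (simp add: sum_distrib_left)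
qed

section \<open>Assembly of the moment formula\<close>

theorem theorem2p8:
  fixes a c q :: "'a::field_char_0" and n :: nat
  assumes "a \<noteq> 0" and "q \<noteq> 0"
    and "\<And>k. k \<ge> 1 \<Longrightarrow> q ^ k \<noteq> 1"
    and "\<And>k. a^2 * c^2 * q ^ k \<noteq> 1"
  shows "4 ^ n * aw_moment a (-a) c (-c) q (2 * n) =
      (\<Sum>m = 0..n.
         qpoch (- (a^2)) q (2 * m) * qpoch (a^2 * c^2) (q^2) m / qpoch (q * a^2 * c^2) (q^2) m
         * (- (q^2)) ^ m *
         (\<Sum>s = 0..2 * n + 2.
            (of_nat ((2 * n + 1) choose s)
               - (if s = 0 then 0 else of_nat ((2 * n + 1) choose (s - 1)))) *
            (\<Sum>p | m + s + p \<le> n.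
               a powi (- 2 * int n + 4 * int p + 2 * int s)
               * qbinom (q^2) (m + p) m * qbinom (q^2) (n - p - s) m
               * q powi (- 2 * int m * (int n - int p - int s) + int m * (int m - 1)))))
    \<and> aw_moment a (-a) c (-c) q (2 * n + 1) = 0"
proof
  define L where "L = aw_functional a (-a) c (-c) q"
  have L: "is_aw_functional a (-a) c (-c) q L"
    unfolding L_def aw_functional_def by (rule theI'[OF ex1_aw_functional])
  note ctx = assms(1,4) L
  show "aw_moment a (-a) c (-c) q (2 * n + 1) = 0"
    using even_functional_monom_odd[OF ctx, of n] by (simp add: aw_moment_def L_def)

  have p: "(q^2) ^ Suc k \<noteq> 1" for k
    using assms(3)[of "2 * Suc k"] by (simp add: power_mult del: power_Suc mult_Suc_right)
  have A0: "a^2 \<noteq> 0" "q^2 \<noteq> 0" using assms by auto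
  define K where "K m = qpoch (- (a^2)) q (2 * m) * qpoch (a^2 * c^2) (q^2) m / qpoch (q * a^2 * c^2) (q^2) m" for m
  define I where "I m s = (\<Sum>p | m + s + p \<le> n.
               a powi (- 2 * int n + 4 * int p + 2 * int s)
               * qbinom (q^2) (m + p) m * qbinom (q^2) (n - p - s) m
               * q powi (- 2 * int m * (int n - int p - int s) + int m * (int m - 1)))" for m s
  let ?b = "\<lambda>s. of_int (ballot (2 * n + 1) s) :: 'a" and ?w = "[:- 2, 0, 4:] :: 'a poly"
  have b: "of_nat ((2 * n + 1) choose s) - (if s = 0 then 0 else of_nat ((2 * n + 1) choose (s - 1))) = ?b s" for s
    by (simp add: ballot_def)
  \<comment> \<open>This lets the range s \<le> n of the Chebyshev expansion be extended to the
    range up to 2n + 2 of the formula.\<close>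
  have I_0: "I m s = 0" if "n < s" for m s
  proof -
    have "{p. m + s + p \<le> n} = {}" using that by auto
    then show ?thesis by (simp add: I_def)
  qed
  \<comment> \<open>The bound n serves every s, so that the sums over s and m can be
    interchanged.\<close>
  have L_cheb: "L (cheb ?w (n - s)) = (\<Sum>m\<le>n. K m * ((- (q^2)) ^ m * I m s))" if "s \<le> n" for s
    unfolding cheb_eq_sum_aw_basis[OF p A0 diff_le_self] even_functional_sum[OF ctx] even_functional_smult[OF ctx] even_functional_aw_basis[OF ctx]
      cheb_coeff_fps_nth_powi[OF p assms(1,2) that] K_def I_def by (simp only: mult_ac)
  \<comment> \<open>With w = 4 x^2 - 2, the variable y = 4 x^2 is w + 2.\<close>
  have "monom (4 ^ n) (2 * n) = (?w + 2) ^ n"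
  proof -
    have "?w + 2 = monom 4 2" by (simp add: numeral_poly monom_altdef numeral_2_eq_2)
    then show ?thesis by (simp add: monom_power)
  qed
  then have "smult (4 ^ n) (monom 1 (2 * n)) = (?w + 2) ^ n"
    by (simp add: smult_monom)
  then have "4 ^ n * L (monom 1 (2 * n)) = L ((?w + 2) ^ n)"
    by (metis even_functional_smult[OF ctx])
  also have "\<dots> = L (\<Sum>s\<le>n. smult (?b s) (cheb ?w (n - s)))"
    unfolding power_eq_sum_cheb by (simp add: of_int_poly)
  also have "\<dots> = (\<Sum>s\<le>n. \<Sum>m\<le>n. K m * (- (q^2)) ^ m * (?b s * I m s))"
    unfolding even_functional_sum[OF ctx] even_functional_smult[OF ctx]
    by (intro sum.cong refl) (simp add: L_cheb sum_distrib_left mult_ac)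
  also have "\<dots> = (\<Sum>m\<le>n. K m * (- (q^2)) ^ m * (\<Sum>s\<le>n. ?b s * I m s))"
    by (subst sum.swap) (simp only: sum_distrib_left)
  also have "\<dots> = (\<Sum>m = 0..n. K m * (- (q^2)) ^ m * (\<Sum>s = 0..2 * n + 2. ?b s * I m s))"
  proof -
    have "(\<Sum>s\<le>n. ?b s * I m s) = (\<Sum>s = 0..2 * n + 2. ?b s * I m s)" for m
      by (intro sum.mono_neutral_left) (auto simp: I_0)
    then show ?thesis by (simp only: atLeast0AtMost)
  qed
  finally show "4 ^ n * aw_moment a (-a) c (-c) q (2 * n) =
      (\<Sum>m = 0..n.
         qpoch (- (a^2)) q (2 * m) * qpoch (a^2 * c^2) (q^2) m / qpoch (q * a^2 * c^2) (q^2) m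
         * (- (q^2)) ^ m *
         (\<Sum>s = 0..2 * n + 2.
            (of_nat ((2 * n + 1) choose s)
               - (if s = 0 then 0 else of_nat ((2 * n + 1) choose (s - 1)))) *
            (\<Sum>p | m + s + p \<le> n.
               a powi (- 2 * int n + 4 * int p + 2 * int s)
               * qbinom (q^2) (m + p) m * qbinom (q^2) (n - p - s) m
               * q powi (- 2 * int m * (int n - int p - int s) + int m * (int m - 1)))))"
    unfolding b K_def I_def aw_moment_def L_def[symmetric] .
qed

end
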